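(* Let $K\subset\mathbb{R}^2$ be a planar convex body. For $p\in\mathrm{bd}K$ let $\angle_K(p)\in(0,\pi]$ denote the angle of $K$ at $p$. (i) Any point $x\in\mathrm{bd}K$ with $\angle_K(x)\le \pi/3$ is a diametral point of $K$. If $x\neq y$ are two points of $\mathrm{bd}K$ with $\angle_K(x)\le\pi/3$ and $\angle_K(y)\le \pi/3$, then the line-segment $xy$ is a diameter of $K$. (ii) If $x,y\in\mathrm{bd}K$ are two distinct points with $\angle_K(x)+\angle_K(y)\le 5\pi/6$, then at least one of $x,y$ is a diametral point of $K$. (iii) If $x,y,z\in\mathrm{bd}K$ are three distinct points with $\angle_K(x)+\angle_K(y)+\angle_K(z)\le 4\pi/3$, then at least one of $x,y,z$ is a diametral point of $K$.
   Context: A planar convex body is a compact convex subset of $\mathbb{R}^2$ with non-empty interior; $\mathrm{bd}K$ is its boundary. For $p\in\mathrm{bd}K$, the angle $\angle_K(p)$ of $K$ at $p$ is the measure of the angle (convex sector with apex $p$) bounded by the tangent cone of $\mathrm{bd}K$ at $p$ and facing $K$, i.e. the angular measure of the closure of $\{p+t(q-p): q\in K,\ t\ge 0\}$; it is at most $\pi$. A diameter of $K$ is a line-segment in $K$ whose length equals the maximal Euclidean distance between pairs of points of $K$. A diametral point of $K$ is an endpoint of some diameter of $K$. *)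

theory Defs
  imports "HOL-Analysis.Analysis"
begin

definition convex_body :: "(real^2) set \<Rightarrow> bool" where
  "convex_body K \<longleftrightarrow> compact K \<and> convex K \<and> interior K \<noteq> {}"

definition tangent_sector :: "(real^2) set \<Rightarrow> real^2 \<Rightarrow> (real^2) set" where
  "tangent_sector K p = closure {p + t *\<^sub>R (q - p) |t q. q \<in> K \<and> t \<ge> 0}"

text \<open>
  The angular measure of a closed sector with apex \<open>p\<close> is the Lebesgue measure of the set of
  those polar angles around \<open>p\<close>, taken over one full turn, whose directions lie in the sector.
  The set measured is Borel because the sector is closed.
\<close>

definition angle_at :: "(real^2) set \<Rightarrow> real^2 \<Rightarrow> real" where
  "angle_at K p =
     measure lborel {\<phi> \<in> {0..<2 * pi}. p + vector [cos \<phi>, sin \<phi>] \<in> tangent_sector K p}"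

text \<open>
  The library function \<open>diameter\<close> is the supremum of the pairwise distances, which for nonempty
  compact \<open>K\<close> is their maximum. A diameter in the sense below is a segment realising it.
\<close>

definition is_diameter :: "(real^2) set \<Rightarrow> (real^2) set \<Rightarrow> bool" where
  "is_diameter K S \<longleftrightarrow> (\<exists>a b. S = closed_segment a b \<and> S \<subseteq> K \<and> dist a b = diameter K)"

definition diametral_point :: "(real^2) set \<Rightarrow> real^2 \<Rightarrow> bool" where
  "diametral_point K p \<longleftrightarrow> (\<exists>q. is_diameter K (closed_segment p q))"

end

(*
  Let ab be a diameter of K, of length D. If x is not diametral then xa, xb < D, so the angle axb,
  and with it the angle of K at x, exceeds pi/3.

  Two points y, z on the same side of the line ab have angles with sum at least pi: otherwise for
  some direction both parallel lines through y and z touch K only at these points, and K lies in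
  the strip between them, which is impossible because y and z also lie in the strip bounded by
  the normals to ab at a and b.

  For x, y on opposite sides of ab, scale so that a = (-1,0), b = (1,0), x = (s,A), y = (t,-B), and
  let u, v be the cotangents of the angles axb and ayb. On the circles through a and b with these
  inscribed angles, |xy|^2 = 2 + 2uA + 2vB + 2AB - 2st. Replacing s and t by their absolute
  values does not increase it, and then the constraint that x and y have distance at most 2 from
  a bounds s and t above and A and B below by the values for x, y at distance exactly 2 from a.
  At those values |xy| >= 2 if the two angles sum to at most 5pi/6, so that xy would be a diameter.

  Among three points two lie on the same side of ab, which gives a total above pi + pi/3.
*)
theory Submission
  imports Defs
begin

section \<open>Plane vectors: cross product and polar form\<close>

definition cross :: "real^2 \<Rightarrow> real^2 \<Rightarrow> real" where
  "cross u v = u$1 * v$2 - u$2 * v$1"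

definition dir :: "real \<Rightarrow> real^2" where
  "dir \<phi> = vector [cos \<phi>, sin \<phi>]"

text \<open>The generated cone moved to the origin, before taking the closure. It is stable under
  sums and nonnegative multiples, and its directions lie in \<open>tangent_sector\<close>, so it
  bounds \<open>angle_at\<close> from below.\<close>

definition cone_at :: "(real^2) set \<Rightarrow> real^2 \<Rightarrow> (real^2) set" where
  "cone_at K p = {t *\<^sub>R (q - p) |t q. q \<in> K \<and> t \<ge> 0}"

lemma dir_nth [simp]: "dir \<phi> $ 1 = cos \<phi>" "dir \<phi> $ 2 = sin \<phi>"
  by (simp_all add: dir_def)

lemma vec2_eq_iff: "(u::real^2) = v \<longleftrightarrow> u$1 = v$1 \<and> u$2 = v$2"
  by (simp add: vec_eq_iff forall_2)

lemma inner_vec2: "(u::real^2) \<bullet> v = u$1 * v$1 + u$2 * v$2"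
  by (simp add: inner_vec_def sum_2)

lemma norm_vec2: "(norm (u::real^2))\<^sup>2 = (u$1)\<^sup>2 + (u$2)\<^sup>2"
  unfolding power2_norm_eq_inner by (simp add: inner_vec2 power2_eq_square)

lemma dir_add_pi: "dir (\<phi> + pi) = - dir \<phi>"
  by (simp add: vec2_eq_iff)

lemma dir_nonzero: "dir \<phi> \<noteq> 0"
  using sin_cos_squared_add[of \<phi>] by (auto simp: vec2_eq_iff simp del: sin_cos_squared_add sin_cos_squared_add2)

lemma continuous_dir: "continuous_on A dir"
proof -
  have eq: "dir = (\<lambda>\<phi>. cos \<phi> *\<^sub>R axis 1 1 + sin \<phi> *\<^sub>R axis 2 1)"
    by (auto simp: fun_eq_iff vec2_eq_iff axis_def)
  show ?thesis
    unfolding eq by (intro continuous_intros)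
qed

lemma polar_vec2:
  fixes u :: "real^2"
  obtains \<phi> where "0 \<le> \<phi>" "\<phi> < 2 * pi" "u = norm u *\<^sub>R dir \<phi>"
proof (cases "u = 0")
  case True
  then show ?thesis using that[of 0] by simp
next
  case False
  then have n: "norm u > 0" by simp
  then have "(u$1 / norm u)\<^sup>2 + (u$2 / norm u)\<^sup>2 = 1"
    by (simp add: power_divide norm_vec2[symmetric] flip: add_divide_distrib)
  then obtain \<phi> where \<phi>: "0 \<le> \<phi>" "\<phi> < 2*pi" "u$1 / norm u = cos \<phi>" "u$2 / norm u = sin \<phi>"
    by (rule sincos_total_2pi)
  have "u = norm u *\<^sub>R dir \<phi>"
    using n by (simp add: vec2_eq_iff flip: \<phi>(3,4))
  with \<phi>(1,2) show ?thesis by (rule that)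
qed

lemma cross_zero_scaleR:
  assumes "cross e v = 0" "e \<noteq> 0"
  obtains c where "v = c *\<^sub>R e"
proof -
  from assms(2) have n: "(e$1)\<^sup>2 + (e$2)\<^sup>2 \<noteq> 0" by (auto simp: vec2_eq_iff)
  show ?thesis
  proof
    show "v = ((e \<bullet> v) / (e \<bullet> e)) *\<^sub>R e"
      using n assms(1)
      by (simp add: vec2_eq_iff inner_vec2 cross_def divide_simps power2_eq_square) algebra
  qed
qed

section \<open>The cone generated by a convex set at a point\<close>

lemma cone_atI:
  assumes "q \<in> K" "t \<ge> 0"
  shows "t *\<^sub>R (q - p) \<in> cone_at K p"
  using assms by (auto simp: cone_at_def)

lemma cone_at_scaleR:
  assumes "d \<in> cone_at K p" "t \<ge> 0"
  shows "t *\<^sub>R d \<in> cone_at K p"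
proof -
  obtain r q where "d = r *\<^sub>R (q - p)" "q \<in> K" "r \<ge> 0" using assms(1) by (auto simp: cone_at_def)
  then show ?thesis using cone_atI[of q K "t * r" p] assms(2) by simp
qed

text \<open>The sum is \<open>r + r'\<close> times the vector from \<open>p\<close> to the weighted
  mean of \<open>q\<close> and \<open>q'\<close>, which is in \<open>K\<close> by convexity.\<close>

lemma cone_at_add:
  assumes "convex K" "d \<in> cone_at K p" "d' \<in> cone_at K p"
  shows "d + d' \<in> cone_at K p"
proof -
  obtain r q where d: "d = r *\<^sub>R (q - p)" "q \<in> K" "r \<ge> 0"
    using assms(2) by (auto simp: cone_at_def)
  obtain r' q' where d': "d' = r' *\<^sub>R (q' - p)" "q' \<in> K" "r' \<ge> 0"
    using assms(3) by (auto simp: cone_at_def)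
  show ?thesis
  proof (cases "r + r' = 0")
    case True
    then show ?thesis using d d' assms(2) by (simp add: add_nonneg_eq_0_iff)
  next
    case False
    define c where "c = (r / (r + r')) *\<^sub>R q + (r' / (r + r')) *\<^sub>R q'"
    have "c \<in> K"
      unfolding c_def using d d' False by (intro convexD[OF assms(1)]) (auto simp flip: add_divide_distrib)
    have "(r + r') *\<^sub>R c = r *\<^sub>R q + r' *\<^sub>R q'"
      using False by (simp add: c_def scaleR_right_distrib)
    then have "(r + r') *\<^sub>R (c - p) = d + d'"
      by (simp add: d d' algebra_simps)
    then show ?thesis using cone_atI[OF \<open>c \<in> K\<close>, of "r + r'" p] d d' by simp
  qed
qed

lemma cone_at_tangent_sector: "d \<in> cone_at K p \<Longrightarrow> p + d \<in> tangent_sector K p"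
  unfolding tangent_sector_def cone_at_def
  by (rule subsetD[OF closure_subset]) auto

section \<open>Measuring sets of directions\<close>

lemma direction_set_sets:
  "{\<phi> \<in> {0..<2*pi}. p + dir \<phi> \<in> tangent_sector K p} \<in> sets borel"
proof -
  have "closed ((\<lambda>\<phi>. p + dir \<phi>) -` tangent_sector K p)"
    by (intro closed_vimage continuous_intros continuous_dir) (simp add: tangent_sector_def)
  then have "{0..<2*pi} \<inter> ((\<lambda>\<phi>. p + dir \<phi>) -` tangent_sector K p) \<in> sets borel"
    by (intro sets.Int) auto
  then show ?thesis by (simp add: vimage_def Int_def)
qed

lemma bounded_lmeasurable_interval:
  fixes S :: "real set"
  assumes "S \<in> sets borel" "S \<subseteq> {a..b}"
  shows "S \<in> lmeasurable"
  by (rule bounded_set_imp_lmeasurable)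
    (use assms bounded_subset[of "{a..b}" S] in auto)

text \<open>The set is Borel, so \<open>lborel\<close> and its completion agree on it; for the
  completion, translation invariance and the facts on \<open>lmeasurable\<close> sets can be
  applied.\<close>

lemma angle_at_lebesgue:
  "angle_at K p = measure lebesgue {\<phi> \<in> {0..<2*pi}. p + dir \<phi> \<in> tangent_sector K p}"
  unfolding angle_at_def dir_def[symmetric]
  using direction_set_sets by (simp add: measure_completion)

lemma direction_set_lmeasurable:
  "{\<phi> \<in> {0..<2*pi}. p + dir \<phi> \<in> tangent_sector K p} \<in> lmeasurable"
  by (rule bounded_lmeasurable_interval[OF direction_set_sets, where a = 0 and b = "2 * pi"]) auto

lemma measure_le_angle_at:
  assumes "S \<in> lmeasurable" "S \<subseteq> {0..<2*pi}" "\<And>\<phi>. \<phi> \<in> S \<Longrightarrow> dir \<phi> \<in> cone_at K p"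
  shows "measure lebesgue S \<le> angle_at K p"
  unfolding angle_at_lebesgue
  by (rule measure_mono_fmeasurable)
    (use assms direction_set_lmeasurable cone_at_tangent_sector in \<open>auto dest: fmeasurableD\<close>)

text \<open>The directions of the tangent cone, up to sign.\<close>

definition line_set :: "(real^2) set \<Rightarrow> real^2 \<Rightarrow> real set" where
  "line_set K p = {\<phi> \<in> {0..<pi}. p + dir \<phi> \<in> tangent_sector K p}
     \<union> (+) (-pi) ` {\<phi> \<in> {pi..<2*pi}. p + dir \<phi> \<in> tangent_sector K p}"

text \<open>Shifting the second half of the turn back by \<open>pi\<close> preserves its measure; an
  overlap with the first half can only make the union smaller.\<close>

lemma line_set:
  shows line_set_lmeasurable: "line_set K p \<in> lmeasurable"
    and measure_line_set: "measure lebesgue (line_set K p) \<le> angle_at K p"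
proof -
  let ?S = "{\<phi> \<in> {0..<2*pi}. p + dir \<phi> \<in> tangent_sector K p}"
  let ?A = "{\<phi> \<in> {0..<pi}. p + dir \<phi> \<in> tangent_sector K p}"
  let ?B = "{\<phi> \<in> {pi..<2*pi}. p + dir \<phi> \<in> tangent_sector K p}"
  have A: "?A = ?S \<inter> {0..<pi}" and B: "?B = ?S \<inter> {pi..<2*pi}"
    using pi_gt_zero by auto
  have "?A \<in> sets borel" "?B \<in> sets borel"
    unfolding A B using direction_set_sets by auto
  then have m: "?A \<in> lmeasurable" "?B \<in> lmeasurable"
    by (auto elim!: bounded_lmeasurable_interval[where a = 0 and b = "2*pi"])
  have t: "(+) (-pi) ` ?B \<in> lmeasurable"
    using m(2) measurable_translation by blast
  show "line_set K p \<in> lmeasurable"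
    unfolding line_set_def using m t by blast
  have "measure lebesgue (line_set K p) \<le> measure lebesgue ?A + measure lebesgue ((+) (-pi) ` ?B)"
    unfolding line_set_def by (rule measure_Un_le) (use m t in \<open>auto dest: fmeasurableD\<close>)
  also have "\<dots> = measure lebesgue ?A + measure lebesgue ?B"
    by (simp only: measure_translation)
  also have "\<dots> = measure lebesgue (?A \<union> ?B)"
  proof -
    have "?A \<inter> ?B = {}" by auto
    then show ?thesis using measure_Un3[OF m] by simp
  qed
  also have "?A \<union> ?B = ?S"
    using pi_gt_zero by auto
  finally show "measure lebesgue (line_set K p) \<le> angle_at K p"
    by (simp add: angle_at_lebesgue)
qed

lemma mem_line_set:
  assumes "\<phi> \<in> {0..<pi}" "dir \<phi> \<in> cone_at K p \<or> - dir \<phi> \<in> cone_at K p"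
  shows "\<phi> \<in> line_set K p"
  using assms(2)
proof
  assume "dir \<phi> \<in> cone_at K p"
  then show ?thesis using assms(1) by (auto simp: line_set_def cone_at_tangent_sector)
next
  assume "- dir \<phi> \<in> cone_at K p"
  then have "p + dir (\<phi> + pi) \<in> tangent_sector K p"
    by (simp only: dir_add_pi cone_at_tangent_sector)
  then have "-pi + (\<phi> + pi) \<in> line_set K p"
    unfolding line_set_def using assms(1) by (intro UnI2 imageI) auto
  then show ?thesis by simp
qed

lemma angle_at_ge_pi:
  assumes "\<And>e. e \<noteq> 0 \<Longrightarrow> e \<in> cone_at K p \<or> - e \<in> cone_at K p"
  shows "pi \<le> angle_at K p"
proof -
  have "{0..<pi} \<subseteq> line_set K p"
    using assms dir_nonzero by (auto intro!: mem_line_set)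
  then have "measure lebesgue {0..<pi} \<le> measure lebesgue (line_set K p)"
    by (intro measure_mono_fmeasurable line_set_lmeasurable) auto
  then show ?thesis using measure_line_set[of K p] by simp
qed

text \<open>The sets \<open>line_set K y\<close> and \<open>line_set K z\<close> together cover
  \<open>{0..<pi}\<close>. Conversely read: if the angles sum to less than \<open>pi\<close>, some
  line direction avoids both cones.\<close>

lemma angle_at_sum_ge_pi:
  assumes "\<And>e. e \<noteq> 0 \<Longrightarrow> e \<in> cone_at K y \<or> - e \<in> cone_at K y \<or> e \<in> cone_at K z \<or> - e \<in> cone_at K z"
  shows "pi \<le> angle_at K y + angle_at K z"
proof -
  have "{0..<pi} \<subseteq> line_set K y \<union> line_set K z"
    using assms dir_nonzero mem_line_set by blast
  then have "measure lebesgue {0..<pi} \<le> measure lebesgue (line_set K y \<union> line_set K z)"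
    by (intro measure_mono_fmeasurable fmeasurable.Un line_set_lmeasurable) auto
  also have "\<dots> \<le> measure lebesgue (line_set K y) + measure lebesgue (line_set K z)"
    by (intro measure_Un_le fmeasurableD line_set_lmeasurable)
  finally show ?thesis using measure_line_set[of K y] measure_line_set[of K z] by simp
qed

section \<open>Lines that meet the cone only in its apex\<close>

lemma exists_off_line:
  assumes "interior K \<noteq> {}" "u \<noteq> 0"
  obtains w where "w \<in> K" "cross u (w - p) \<noteq> 0"
proof -
  \<comment> \<open>A normal of the line through \<open>p\<close> along \<open>u\<close>; this line
    has empty interior, so it cannot contain \<open>K\<close>.\<close>
  define n :: "real^2" where "n = vector [- u$2, u$1]"
  have eq: "cross u (w - p) = n \<bullet> w - n \<bullet> p" for w
    by (simp add: n_def cross_def inner_vec2 algebra_simps)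
  have "n \<noteq> 0" using assms(2) by (auto simp: n_def vec2_eq_iff)
  then have "interior {w. n \<bullet> w = n \<bullet> p} = {}" by (rule interior_hyperplane)
  then have "\<not> K \<subseteq> {w. n \<bullet> w = n \<bullet> p}"
    using assms(1) interior_mono by blast
  then show ?thesis using that eq by auto
qed

text \<open>
  Opposite signs would give a point of the cone on the line, hence opposite rays in the cone;
  since \<open>K\<close> is not contained in a line, the cone would then contain a half-plane.
\<close>

lemma one_sided:
  assumes K: "convex K" "interior K \<noteq> {}" and e: "e \<noteq> 0" "e \<notin> cone_at K y" "- e \<notin> cone_at K y"
  shows "(\<forall>q\<in>K - {y}. cross e (q - y) > 0) \<or> (\<forall>q\<in>K - {y}. cross e (q - y) < 0)"
proof -
  \<comment> \<open>A nonzero cone vector parallel to \<open>e\<close> is, after positive rescaling,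
    \<open>e\<close> or \<open>- e\<close>.\<close>
  have zero: "d = 0" if d: "d \<in> cone_at K y" "cross e d = 0" for d
  proof (rule ccontr)
    assume "d \<noteq> 0"
    obtain c where c: "d = c *\<^sub>R e" using cross_zero_scaleR[OF d(2) e(1)] .
    then have "c \<noteq> 0" using \<open>d \<noteq> 0\<close> by auto
    have "(1 / \<bar>c\<bar>) *\<^sub>R d \<in> cone_at K y" using that(1) by (rule cone_at_scaleR) simp
    then show False using c \<open>c \<noteq> 0\<close> e by (cases "c > 0") (auto simp: abs_if split: if_splits)
  qed
  have inK: "q - y \<in> cone_at K y" if "q \<in> K" for q
    using cone_atI[OF that, of 1 y] by simp
  have nz: "cross e (q - y) \<noteq> 0" if "q \<in> K - {y}" for q
    using zero[OF inK, of q] that by auto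
  \<comment> \<open>The positive combination whose cross product with \<open>e\<close> cancels lies
    in the cone, hence vanishes: points on opposite sides are on opposite rays from
    \<open>y\<close>.\<close>
  have par: "cross e (r - y) *\<^sub>R (q - y) = cross e (q - y) *\<^sub>R (r - y)"
    if "q \<in> K" "r \<in> K" "cross e (q - y) < 0" "cross e (r - y) > 0" for q r
  proof -
    have "cross e (r - y) *\<^sub>R (q - y) + (- cross e (q - y)) *\<^sub>R (r - y) = 0"
    proof (rule zero)
      show "cross e (r - y) *\<^sub>R (q - y) + (- cross e (q - y)) *\<^sub>R (r - y) \<in> cone_at K y"
        using that by (intro cone_at_add[OF K(1)] cone_at_scaleR inK) auto
    qed (simp add: cross_def algebra_simps)
    then show ?thesis by simp
  qed
  show ?thesis
  proof (rule ccontr)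
    assume "\<not> ?thesis"
    then obtain q r where qr: "q \<in> K" "r \<in> K" "cross e (q - y) < 0" "cross e (r - y) > 0"
      using nz by (meson DiffD1 linorder_neqE_linordered_idom)
    have "q \<noteq> y" "r \<noteq> y" using qr by (auto simp: cross_def)
    then obtain w where w: "w \<in> K" "cross (q - y) (w - y) \<noteq> 0"
      using exists_off_line[OF K(2), of "q - y" y] by auto
    then have "w \<noteq> y" by (auto simp: cross_def)
    have cr: "cross u v = 0" if "k *\<^sub>R u = l *\<^sub>R v" "k \<noteq> 0" for u v and k l :: real
    proof -
      have "k * cross u v = cross (k *\<^sub>R u) v" by (simp add: cross_def algebra_simps)
      also have "\<dots> = 0" unfolding that(1) by (simp add: cross_def)
      finally show ?thesis using that(2) by simp
    qed
    show False
    \<comment> \<open>If \<open>w\<close> is on the side of \<open>r\<close>, then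
      \<open>q - y\<close> and \<open>w - y\<close> are parallel by \<open>par\<close>; otherwise
      both are parallel to \<open>r - y\<close>. Either contradicts the choice of
      \<open>w\<close>.\<close>
    proof (cases "cross e (w - y) > 0")
      case True
      then show False using par[OF qr(1) w(1) qr(3)] cr w(2) by auto
    next
      case False
      then have neg: "cross e (w - y) < 0" using nz w(1) \<open>w \<noteq> y\<close> by fastforce
      have q: "cross e (r - y) *\<^sub>R (q - y) = cross e (q - y) *\<^sub>R (r - y)"
        and w': "cross e (r - y) *\<^sub>R (w - y) = cross e (w - y) *\<^sub>R (r - y)"
        using par qr w(1) neg by auto
      have "cross e (w - y) *\<^sub>R cross e (r - y) *\<^sub>R (q - y)
          = cross e (q - y) *\<^sub>R cross e (r - y) *\<^sub>R (w - y)"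
        unfolding q w' by simp
      then have "(cross e (w - y) * cross e (r - y)) *\<^sub>R (q - y)
          = (cross e (q - y) * cross e (r - y)) *\<^sub>R (w - y)"
        by simp
      then have "cross (q - y) (w - y) = 0"
        by (rule cr) (use neg qr(4) in simp)
      then show False using w(2) by simp
    qed
  qed
qed

section \<open>The angle at a point is at least the angle subtended there by two points of the
  body\<close>

text \<open>Cramer's rule in the basis \<open>dir s\<close>, \<open>dir t\<close>, whose determinant
  is \<open>sin (t - s)\<close>.\<close>

lemma dir_combination:
  "sin (t - s) *\<^sub>R dir \<phi> = sin (t - \<phi>) *\<^sub>R dir s + sin (\<phi> - s) *\<^sub>R dir t"
  by (simp add: vec2_eq_iff sin_diff algebra_simps)

text \<open>The coordinates are kept as quotients because \<open>sin (t - s)\<close> is negative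
  when \<open>t - s\<close> exceeds half a turn.\<close>

lemma dir_mem_cone:
  assumes "convex K" "dir s \<in> cone_at K p" "dir t \<in> cone_at K p" "sin (t - s) \<noteq> 0"
    and "sin (t - \<phi>) / sin (t - s) \<ge> 0" "sin (\<phi> - s) / sin (t - s) \<ge> 0"
  shows "dir \<phi> \<in> cone_at K p"
proof -
  have "dir \<phi> = (1 / sin (t - s)) *\<^sub>R (sin (t - s) *\<^sub>R dir \<phi>)"
    using assms(4) by simp
  also have "\<dots> = (sin (t - \<phi>) / sin (t - s)) *\<^sub>R dir s + (sin (\<phi> - s) / sin (t - s)) *\<^sub>R dir t"
    unfolding dir_combination[of t s \<phi>] by (simp add: scaleR_right_distrib)
  finally show ?thesis
    using assms by (simp add: cone_at_add cone_at_scaleR)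
qed

text \<open>A line through \<open>p\<close> missing the cone elsewhere would have \<open>q\<close>
  and \<open>r\<close> strictly on the same side, which opposite rays forbid. So the cone meets
  every line direction.\<close>

lemma angle_at_straight:
  assumes "convex_body K" "q \<in> K" "r \<in> K" "q \<noteq> p" "r \<noteq> p" "r - p = c *\<^sub>R (q - p)" "c < 0"
  shows "pi \<le> angle_at K p"
proof (rule angle_at_ge_pi, rule ccontr)
  fix e :: "real^2"
  assume "e \<noteq> 0" "\<not> (e \<in> cone_at K p \<or> - e \<in> cone_at K p)"
  then have "(\<forall>q\<in>K - {p}. cross e (q - p) > 0) \<or> (\<forall>q\<in>K - {p}. cross e (q - p) < 0)"
    using one_sided[of K e p] assms(1) by (auto simp: convex_body_def)
  then have "cross e (q - p) * cross e (r - p) > 0"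
    using assms(2-5) by (auto intro: mult_pos_pos mult_neg_neg)
  moreover have "cross e (r - p) = c * cross e (q - p)"
    unfolding assms(6) by (simp add: cross_def algebra_simps)
  ultimately have "c * (cross e (q - p))\<^sup>2 > 0"
    by (simp add: power2_eq_square mult_ac)
  then show False using assms(7) by (simp add: zero_less_mult_iff)
qed

text \<open>\<open>arccos (cos (t - s))\<close> is the smaller of \<open>t - s\<close> and
  \<open>2 * pi - (t - s)\<close>, the width of the convex sector between the two rays. The cases
  say on which side of half a turn \<open>t - s\<close> lies.\<close>

lemma angle_at_ge_polar:
  assumes K: "convex_body K" and qr: "q \<in> K" "r \<in> K" "q \<noteq> p" "r \<noteq> p"
    and st: "0 \<le> s" "s \<le> t" "t < 2 * pi"
    and s: "q - p = norm (q - p) *\<^sub>R dir s" and t: "r - p = norm (r - p) *\<^sub>R dir t"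
  shows "arccos (cos (t - s)) \<le> angle_at K p"
proof -
  have cv: "convex K" using K by (simp add: convex_body_def)
  have unit: "dir \<phi> \<in> cone_at K p" if "w \<in> K" "w \<noteq> p" "w - p = norm (w - p) *\<^sub>R dir \<phi>" for w \<phi>
  proof -
    have "(1 / norm (w - p)) *\<^sub>R (w - p) = dir \<phi>"
      using that(2) by (subst that(3)) simp
    then show ?thesis using cone_atI[OF that(1), of "1 / norm (w - p)" p] by simp
  qed
  have ds: "dir s \<in> cone_at K p" and dt: "dir t \<in> cone_at K p"
    using unit[OF qr(1) qr(3) s] unit[OF qr(2) qr(4) t] by auto
  consider "t = s" | "s < t" "t - s < pi" | "t - s = pi" | "t - s > pi" using st by linarith
  then show ?thesis
  proof cases
    case 1
    then show ?thesis by (simp add: angle_at_def)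
  next
    case 2
    have pos: "sin (t - s) > 0" using 2 by (intro sin_gt_zero) auto
    have "measure lebesgue {s..t} \<le> angle_at K p"
    proof (rule measure_le_angle_at)
      fix \<phi> assume "\<phi> \<in> {s..t}"
      then show "dir \<phi> \<in> cone_at K p"
        using 2 pos by (intro dir_mem_cone[OF cv ds dt]) (auto intro!: divide_nonneg_pos sin_ge_zero)
    qed (use st in auto)
    then show ?thesis using 2 by (simp add: arccos_cos)
  next
    case 3
    have "r - p = (- norm (r - p) / norm (q - p)) *\<^sub>R (q - p)"
    proof -
      have "dir t = - dir s" using 3 dir_add_pi[of s] by (simp add: algebra_simps)
      then have "r - p = - (norm (r - p) *\<^sub>R dir s)" using t by simp
      also have "dir s = (1 / norm (q - p)) *\<^sub>R (q - p)"
        using qr(3) by (subst s) simp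
      finally show ?thesis by simp
    qed
    then have "pi \<le> angle_at K p"
      by (rule angle_at_straight[OF K qr]) (use qr in \<open>auto simp: divide_neg_pos\<close>)
    then show ?thesis using 3 by simp
  next
    \<comment> \<open>The convex sector now passes through direction 0 and splits into
      \<open>{0..s}\<close> and \<open>{t..<2*pi}\<close>; there both numerators in
      \<open>dir_mem_cone\<close> are nonpositive, as is \<open>sin (t - s)\<close>.\<close>
    case 4
    have neg: "sin (t - s) < 0"
      using sin_gt_zero[of "t - s - pi"] 4 st by (simp add: sin_diff)
    have le: "sin x \<le> 0" if "pi \<le> x" "x \<le> 2 * pi" for x
      using sin_ge_zero[of "x - pi"] that by (simp add: sin_diff)
    have le': "sin x \<le> 0" if "- pi \<le> x" "x \<le> 0" for x
      using sin_ge_zero[of "- x"] that by simp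
    have m: "{0..s} \<in> lmeasurable" "{t..<2*pi} \<in> lmeasurable"
      by (auto intro!: bounded_lmeasurable_interval[where a = t and b = "2*pi"])
    have "measure lebesgue ({0..s} \<union> {t..<2*pi}) \<le> angle_at K p"
    proof (rule measure_le_angle_at)
      fix \<phi> assume "\<phi> \<in> {0..s} \<union> {t..<2*pi}"
      then have "sin (t - \<phi>) \<le> 0 \<and> sin (\<phi> - s) \<le> 0"
      proof
        assume "\<phi> \<in> {0..s}"
        then show ?thesis using 4 st le[of "t - \<phi>"] le'[of "\<phi> - s"] by auto
      next
        assume "\<phi> \<in> {t..<2*pi}"
        then show ?thesis using 4 st le'[of "t - \<phi>"] le[of "\<phi> - s"] by auto
      qed
      then show "dir \<phi> \<in> cone_at K p"
        using neg by (intro dir_mem_cone[OF cv ds dt]) (auto intro!: divide_nonpos_neg)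
    next
      show "{0..s} \<union> {t..<2*pi} \<in> lmeasurable" using m by (intro fmeasurable.Un) auto
    qed (use st in auto)
    moreover have "measure lebesgue ({0..s} \<union> {t..<2*pi}) = measure lebesgue {0..s} + measure lebesgue {t..<2*pi}"
    proof -
      have "{0..s} \<inter> {t..<2*pi} = {}" using 4 pi_gt_zero by auto
      then show ?thesis using measure_Un3[OF m] by simp
    qed
    moreover have "arccos (cos (t - s)) = 2 * pi - (t - s)"
      using arccos_cos[of "2 * pi - (t - s)"] 4 st by (simp add: cos_diff)
    ultimately show ?thesis using st by simp
  qed
qed

lemma angle_at_ge:
  assumes K: "convex_body K" and qr: "q \<in> K" "r \<in> K" "q \<noteq> p" "r \<noteq> p"
  shows "arccos ((q - p) \<bullet> (r - p) / (norm (q - p) * norm (r - p))) \<le> angle_at K p"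
proof -
  obtain s where s: "0 \<le> s" "s < 2*pi" "q - p = norm (q - p) *\<^sub>R dir s" by (rule polar_vec2)
  obtain t where t: "0 \<le> t" "t < 2*pi" "r - p = norm (r - p) *\<^sub>R dir t" by (rule polar_vec2)
  have "(q - p) \<bullet> (r - p) = (norm (q - p) * norm (r - p)) * (dir s \<bullet> dir t)"
    by (subst s(3), subst t(3)) simp
  also have "dir s \<bullet> dir t = cos (t - s)"
    by (simp add: inner_vec2 cos_diff mult.commute)
  finally have eq: "(q - p) \<bullet> (r - p) / (norm (q - p) * norm (r - p)) = cos (t - s)"
    using qr by simp
  show ?thesis
  proof (cases "s \<le> t")
    case True
    then show ?thesis unfolding eq using angle_at_ge_polar[OF K qr] s t by simp
  next
    case False
    have "cos (t - s) = cos (s - t)" by (metis cos_minus minus_diff_eq)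
    then show ?thesis
      unfolding eq using False angle_at_ge_polar[OF K qr(2,1,4,3)] s t by simp
  qed
qed

section \<open>Angles of at most pi/3\<close>

lemma convex_body_facts:
  assumes "convex_body K"
  shows "bounded K" "convex K" "interior K \<noteq> {}"
  using assms by (auto simp: convex_body_def compact_imp_bounded)

text \<open>The angle subtended by \<open>ab\<close> at \<open>x\<close> is at most pi/3, so the law
  of cosines gives \<open>D\<^sup>2 \<le> p\<^sup>2 + q\<^sup>2 - p * q\<close>. With
  \<open>p\<close> and \<open>q\<close> at most \<open>D\<close> this forces all three sides to be
  equal.\<close>

lemma narrow_angle_equilateral:
  assumes K: "convex_body K" and "a \<in> K" "b \<in> K" "x \<in> K" "dist a b = diameter K"
    and "x \<noteq> a" "x \<noteq> b" "angle_at K x \<le> pi / 3"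
  shows "dist x a = diameter K \<and> dist x b = diameter K"
proof -
  define p q D where "p = norm (a - x)" and "q = norm (b - x)" and "D = diameter K"
  have pq: "p > 0" "q > 0" using assms by (auto simp: p_def q_def)
  have le: "p \<le> D" "q \<le> D"
    using diameter_bounded_bound[OF convex_body_facts(1)[OF K] assms(2,4)]
      diameter_bounded_bound[OF convex_body_facts(1)[OF K] assms(3,4)]
    unfolding p_def q_def D_def dist_norm by this+
  let ?c = "(a - x) \<bullet> (b - x) / (p * q)"
  have c: "-1 \<le> ?c" "?c \<le> 1"
    using Cauchy_Schwarz_ineq2[of "a - x" "b - x", folded p_def q_def] pq
    by (simp_all add: abs_le_iff pos_le_divide_eq)
  have "arccos ?c \<le> pi / 3"
    using angle_at_ge[OF K assms(2,3), of x] assms(6,7,8) unfolding p_def q_def by simp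
  then have "cos (pi / 3) \<le> cos (arccos ?c)"
    using c by (intro cos_monotone_0_pi_le) (auto intro: arccos_lbound)
  then have "p * q \<le> 2 * ((a - x) \<bullet> (b - x))"
    using c pq by (simp add: cos_60 field_simps)
  moreover have "D\<^sup>2 = p\<^sup>2 + q\<^sup>2 - 2 * ((a - x) \<bullet> (b - x))"
  proof -
    have "D = norm ((a - x) - (b - x))" using assms(5) by (simp add: D_def dist_norm)
    then show ?thesis
      unfolding p_def q_def power2_norm_eq_inner by (simp add: power2_norm_eq_inner algebra_simps inner_commute)
  qed
  ultimately have *: "D\<^sup>2 \<le> p\<^sup>2 + q\<^sup>2 - p * q" by simp
  have "p = D \<and> q = D"
  proof (cases "p \<le> q")
    \<comment> \<open>The inequality is split into two nonnegative terms, which therefore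
      vanish.\<close>
    case True
    have "p * (q - p) + (D - q) * (D + q) \<le> 0" using * by (simp add: algebra_simps power2_eq_square)
    moreover have "p * (q - p) \<ge> 0" "(D - q) * (D + q) \<ge> 0" using True pq le by auto
    ultimately have "p * (q - p) = 0" "(D - q) * (D + q) = 0" by linarith+
    then show ?thesis using pq le by auto
  next
    case False
    have "q * (p - q) + (D - p) * (D + p) \<le> 0" using * by (simp add: algebra_simps power2_eq_square)
    moreover have "q * (p - q) \<ge> 0" "(D - p) * (D + p) \<ge> 0" using False pq le by auto
    ultimately have "q * (p - q) = 0" "(D - p) * (D + p) = 0" by linarith+
    then show ?thesis using pq le by auto
  qed
  then show ?thesis unfolding p_def q_def D_def by (simp only: dist_norm norm_minus_commute[of x a] norm_minus_commute[of x b])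
qed

section \<open>Two points on the same side of a diameter\<close>

text \<open>The ball around \<open>b\<close> through \<open>a\<close> lies on one side of its
  tangent hyperplane at \<open>a\<close>.\<close>

lemma inner_nonneg_of_dist_le:
  assumes "dist y b \<le> dist a (b::'a::real_inner)"
  shows "(b - a) \<bullet> (y - a) \<ge> 0"
proof -
  have "(norm (y - b))\<^sup>2 \<le> (norm (b - a))\<^sup>2"
    using assms unfolding dist_norm norm_minus_commute[of a b] by (rule power_mono) simp
  moreover have "(norm (y - b))\<^sup>2 = (norm (y - a))\<^sup>2 + (norm (b - a))\<^sup>2 - 2 * ((b - a) \<bullet> (y - a))"
    unfolding power2_norm_eq_inner by (simp add: algebra_simps inner_commute)
  ultimately show ?thesis using zero_le_power2[of "norm (y - a)"] by linarith
qed

text \<open>By the distance bounds, the components along \<open>b - a\<close> contribute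
  nonnegatively to \<open>cross e (y - a)\<close> and nonpositively to
  \<open>cross e (z - b)\<close>. The strict signs must then come from the transverse components,
  which puts \<open>y\<close> and \<open>z\<close> strictly on opposite sides of the line
  \<open>ab\<close>.\<close>

lemma strip_contradiction:
  assumes "dist y b \<le> dist a b" "dist z a \<le> dist a b"
    and "cross (b - a) (y - a) * cross (b - a) (z - a) \<ge> 0"
    and "cross e (y - a) < 0" "cross e (b - a) \<ge> 0" "cross e (z - b) > 0"
  shows False
proof -
  define w where "w = b - a"
  \<comment> \<open>\<open>v\<close> is split along \<open>w\<close> and across it, with the
    denominator \<open>w \<bullet> w\<close> cleared.\<close>
  have id: "(w \<bullet> w) * cross e v = cross e w * (w \<bullet> v) + (e \<bullet> w) * cross w v" for v
    by (simp add: cross_def inner_vec2 algebra_simps)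
  have "a \<noteq> b" using assms(1,4) by (auto simp: cross_def)
  then have w: "w \<bullet> w > 0" by (simp add: w_def)
  have y: "w \<bullet> (y - a) \<ge> 0" using inner_nonneg_of_dist_le[OF assms(1)] by (simp add: w_def)
  have "(a - b) \<bullet> (z - b) \<ge> 0"
    using inner_nonneg_of_dist_le[of z a b] assms(2) by (simp add: dist_commute)
  then have z: "w \<bullet> (z - b) \<le> 0" by (simp add: w_def algebra_simps)
  have "(w \<bullet> w) * cross e (y - a) < 0" "(w \<bullet> w) * cross e (z - b) > 0"
    using w assms by (auto simp: mult_pos_neg)
  moreover have "cross e w * (w \<bullet> (y - a)) \<ge> 0" "cross e w * (w \<bullet> (z - b)) \<le> 0"
    using y z assms(5) by (auto simp: w_def mult_nonneg_nonpos)
  ultimately have "(e \<bullet> w) * cross w (y - a) < 0" "(e \<bullet> w) * cross w (z - b) > 0"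
    unfolding id by linarith+
  moreover have "cross w (z - b) = cross w (z - a)" by (simp add: w_def cross_def algebra_simps)
  ultimately have "((e \<bullet> w) * cross w (y - a)) * ((e \<bullet> w) * cross w (z - a)) < 0"
    by (simp add: mult_neg_pos)
  then have "(e \<bullet> w)\<^sup>2 * (cross w (y - a) * cross w (z - a)) < 0"
    by (simp add: power2_eq_square mult_ac)
  moreover have "(e \<bullet> w)\<^sup>2 * (cross w (y - a) * cross w (z - a)) \<ge> 0"
    using assms(3) by (simp add: w_def)
  ultimately show False by linarith
qed

text \<open>If some \<open>e\<close> avoids both cones up to sign, \<open>cross e\<close> has strict
  extremes over \<open>K\<close> at \<open>y\<close> and at \<open>z\<close>. As the points differ,
  one is the minimum and the other the maximum, with \<open>a\<close> and \<open>b\<close> strictly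
  between; \<open>strip_contradiction\<close> excludes this.\<close>

lemma same_side_angle_sum:
  assumes K: "convex_body K" and abyz: "a \<in> K" "b \<in> K" "y \<in> K" "z \<in> K" and D: "dist a b = diameter K"
    and ne: "y \<noteq> a" "y \<noteq> b" "z \<noteq> a" "z \<noteq> b" "y \<noteq> z"
    and side: "cross (b - a) (y - a) * cross (b - a) (z - a) \<ge> 0"
  shows "pi \<le> angle_at K y + angle_at K z"
proof (rule angle_at_sum_ge_pi, rule ccontr)
  fix e :: "real^2"
  assume e: "e \<noteq> 0"
    and n: "\<not> (e \<in> cone_at K y \<or> - e \<in> cone_at K y \<or> e \<in> cone_at K z \<or> - e \<in> cone_at K z)"
  note facts = convex_body_facts[OF K]
  have le: "dist p q \<le> dist a b" if "p \<in> K" "q \<in> K" for p q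
    using diameter_bounded_bound[OF facts(1) that] D by simp
  have diff: "cross e (p - q) = cross e p - cross e q" for p q by (simp add: cross_def algebra_simps)
  have side': "cross (a - b) (y - b) * cross (a - b) (z - b) \<ge> 0"
  proof -
    have "cross (a - b) (v - b) = - cross (b - a) (v - a)" for v by (simp add: cross_def algebra_simps)
    then show ?thesis using side by simp
  qed
  note sides = side side'
  have y: "(\<forall>q\<in>K - {y}. cross e (q - y) > 0) \<or> (\<forall>q\<in>K - {y}. cross e (q - y) < 0)"
    and z: "(\<forall>q\<in>K - {z}. cross e (q - z) > 0) \<or> (\<forall>q\<in>K - {z}. cross e (q - z) < 0)"
    using one_sided[OF facts(2,3) e] n by auto
  \<comment> \<open>Here \<open>y'\<close> is the minimum and \<open>z'\<close> the maximum. The end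
    of the diameter with the smaller value of \<open>cross e\<close> has to come first, so
    \<open>a\<close> and \<open>b\<close> may trade places.\<close>
  have no: False if yz: "y' \<in> K" "z' \<in> K" "cross (b - a) (y' - a) * cross (b - a) (z' - a) \<ge> 0"
    "cross (a - b) (y' - b) * cross (a - b) (z' - b) \<ge> 0"
    "cross e y' < cross e a" "cross e y' < cross e b" "cross e a < cross e z'" "cross e b < cross e z'" for y' z'
  proof (cases "cross e a \<le> cross e b")
    case True
    show False
      by (rule strip_contradiction[of y' b a z' e]) (use le yz abyz True in \<open>auto simp: diff\<close>)
  next
    case False
    show False
      by (rule strip_contradiction[of y' a b z' e]) (use le yz abyz False in \<open>auto simp: diff dist_commute[of b a]\<close>)
  qed
  have "(cross e y < cross e a \<and> cross e y < cross e b \<and> cross e y < cross e z) \<or>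
      (cross e a < cross e y \<and> cross e b < cross e y \<and> cross e z < cross e y)"
    using y ne abyz by (auto simp: diff)
  moreover have "(cross e z < cross e a \<and> cross e z < cross e b \<and> cross e z < cross e y) \<or>
      (cross e a < cross e z \<and> cross e b < cross e z \<and> cross e y < cross e z)"
    using z ne abyz by (auto simp: diff)
  ultimately have "(cross e y < cross e a \<and> cross e y < cross e b \<and> cross e a < cross e z \<and> cross e b < cross e z) \<or>
     (cross e z < cross e a \<and> cross e z < cross e b \<and> cross e a < cross e y \<and> cross e b < cross e y)"
    by linarith
  then show False
    using no[of y z] no[of z y] abyz sides by (auto simp: mult.commute)
qed

section \<open>Two points on opposite sides of a diameter\<close>

text \<open>The point \<open>(s, A)\<close> sees the chord from \<open>(-1,0)\<close> to
  \<open>(1,0)\<close> under an angle with cotangent \<open>u\<close>, and \<open>far\<close> bounds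
  its distance from the farther end by 2. Both conclusions are equalities when that distance is
  2.\<close>

lemma arc_bound:
  fixes s A u :: real
  assumes A: "A > 0" and far: "(1 + \<bar>s\<bar>)\<^sup>2 + A\<^sup>2 \<le> 4" and u: "u \<ge> 0" "2 * u * A = s\<^sup>2 - 1 + A\<^sup>2"
  shows "4 * u \<le> A * (1 + u\<^sup>2)" "(1 + u\<^sup>2) * \<bar>s\<bar> \<le> 1 - 3 * u\<^sup>2"
proof -
  define r where "r = 1 - \<bar>s\<bar>"
  have s2: "s\<^sup>2 = \<bar>s\<bar>\<^sup>2" by simp
  \<comment> \<open>The circle equation makes \<open>far\<close> linear:
    \<open>\<bar>s\<bar> + u * A \<le> 1\<close>.\<close>
  have r: "u * A \<le> r" using far u(2) by (simp add: r_def power2_eq_square algebra_simps)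
  have "r \<le> 1" by (simp add: r_def)
  have eq: "A\<^sup>2 - 2 * u * A = r * (2 - r)"
    unfolding u(2) r_def using s2 by (simp add: power2_eq_square algebra_simps)
  \<comment> \<open>By \<open>eq\<close> this product equals
    \<open>A * (A * (1 + u\<^sup>2) - 4 * u)\<close>.\<close>
  have "(r - u * A) * (2 - r - u * A) \<ge> 0" using r \<open>r \<le> 1\<close> by (intro mult_nonneg_nonneg) auto
  then have "A * (A * (1 + u\<^sup>2) - 4 * u) \<ge> 0" using eq by (simp add: power2_eq_square algebra_simps)
  then show 1: "4 * u \<le> A * (1 + u\<^sup>2)" using A by (simp add: zero_le_mult_iff)
  have "(1 + u\<^sup>2) * \<bar>s\<bar> \<le> (1 + u\<^sup>2) * (1 - u * A)"
    using r by (intro mult_left_mono) (auto simp: r_def)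
  also have "\<dots> = 1 + u\<^sup>2 - u * (A * (1 + u\<^sup>2))" by (simp add: algebra_simps)
  also have "\<dots> \<le> 1 + u\<^sup>2 - u * (4 * u)" using 1 u(1) by (simp add: mult_left_mono)
  finally show "(1 + u\<^sup>2) * \<bar>s\<bar> \<le> 1 - 3 * u\<^sup>2" by (simp add: power2_eq_square)
qed

text \<open>The points are \<open>(s, A)\<close> and \<open>(t, - B)\<close>, with cotangents
  \<open>X / (2 * A)\<close> and \<open>Y / (2 * B)\<close>; \<open>ang\<close> says that their
  angles sum to at most 5pi/6, cleared of denominators. For fixed cotangents
  \<open>arc_bound\<close> reduces the claim to an inequality in \<open>u\<close> and
  \<open>v\<close>.\<close>

lemma opposite_points_far:
  fixes s t A B :: real
  defines "X \<equiv> s\<^sup>2 - 1 + A\<^sup>2" and "Y \<equiv> t\<^sup>2 - 1 + B\<^sup>2"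
  assumes AB: "A > 0" "B > 0" and far: "(1 + \<bar>s\<bar>)\<^sup>2 + A\<^sup>2 \<le> 4" "(1 + \<bar>t\<bar>)\<^sup>2 + B\<^sup>2 \<le> 4"
    and XY: "X \<ge> 0" "Y \<ge> 0" and ang: "X * Y - 4 * A * B + 2 * sqrt 3 * (A * Y + B * X) \<ge> 0"
  shows "4 \<le> (s - t)\<^sup>2 + (A + B)\<^sup>2"
proof -
  define u v where "u = X / (2 * A)" and "v = Y / (2 * B)"
  have u: "u \<ge> 0" "2 * u * A = X" and v: "v \<ge> 0" "2 * v * B = Y"
    using AB XY by (auto simp: u_def v_def)
  have "X * Y - 4 * A * B + 2 * sqrt 3 * (A * Y + B * X) = 4 * A * B * (u * v - 1 + sqrt 3 * (u + v))"
    unfolding u(2)[symmetric] v(2)[symmetric] by (simp add: algebra_simps)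
  with ang have "0 \<le> 4 * A * B * (u * v - 1 + sqrt 3 * (u + v))" by simp
  moreover have "4 * A * B > 0" using AB by simp
  ultimately have "0 \<le> u * v - 1 + sqrt 3 * (u + v)" by (metis linorder_not_le mult_pos_neg)
  then have uv: "1 - u * v \<le> sqrt 3 * (u + v)" by simp
  note bu = arc_bound[OF AB(1) far(1) u(1) u(2)[unfolded X_def]]
    and bv = arc_bound[OF AB(2) far(2) v(1) v(2)[unfolded Y_def]]
  have p: "1 + u\<^sup>2 > 0" "1 + v\<^sup>2 > 0" by (auto intro: add_pos_nonneg)
  have "0 \<le> (1 + u\<^sup>2) * \<bar>s\<bar>" "0 \<le> (1 + v\<^sup>2) * \<bar>t\<bar>" by simp_all
  then have small: "3 * u\<^sup>2 \<le> 1" "3 * v\<^sup>2 \<le> 1" using bu bv by linarith+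
  \<comment> \<open>Squaring \<open>uv\<close> requires \<open>1 - u * v\<close> to be
    nonnegative.\<close>
  have "2 * (u * v) \<le> u\<^sup>2 + v\<^sup>2" using zero_le_power2[of "u - v"] by (simp add: power2_diff)
  then have "0 \<le> 1 - u * v" using small by linarith
  with uv have "(1 - u * v)\<^sup>2 \<le> (sqrt 3 * (u + v))\<^sup>2" by (rule power_mono)
  then have key: "(1 - u * v)\<^sup>2 \<le> 3 * (u + v)\<^sup>2" by (simp add: power_mult_distrib)
  define P Q S T where "P = 1 + u\<^sup>2" and "Q = 1 + v\<^sup>2" and "S = \<bar>s\<bar>" and "T = \<bar>t\<bar>"
  note bu = bu[folded P_def S_def] and bv = bv[folded Q_def T_def] and p = p[folded P_def Q_def]
  have st: "P * S * (Q * T) \<le> (1 - 3 * u\<^sup>2) * (1 - 3 * v\<^sup>2)"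
    by (rule mult_mono[OF bu(2) bv(2)]) (use small p in \<open>simp_all add: T_def\<close>)
  have AB': "(4 * u) * (4 * v) \<le> A * P * (B * Q)"
    by (rule mult_mono[OF bu(1) bv(1)]) (use v(1) AB p in simp_all)
  have uA: "u * Q * (4 * u) \<le> u * Q * (A * P)"
    by (rule mult_left_mono[OF bu(1)]) (use u(1) p in simp)
  have vB: "v * P * (4 * v) \<le> v * P * (B * Q)"
    by (rule mult_left_mono[OF bv(1)]) (use v(1) p in simp)
  have "0 \<le> 2 * (3 * (u + v)\<^sup>2 - (1 - u * v)\<^sup>2)" using key by simp
  \<comment> \<open>The right side is \<open>P * Q * (u * A + v * B + A * B - S * T - 1)\<close>
    evaluated at the bounds of \<open>arc_bound\<close>.\<close>
  also have "\<dots> = u * Q * (4 * u) + v * P * (4 * v) + (4 * u) * (4 * v)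
      - (1 - 3 * u\<^sup>2) * (1 - 3 * v\<^sup>2) - P * Q"
    unfolding P_def Q_def by (simp add: power2_eq_square algebra_simps)
  also have "\<dots> \<le> u * Q * (A * P) + v * P * (B * Q) + A * P * (B * Q) - P * S * (Q * T) - P * Q"
    by (intro diff_mono add_mono st AB' uA vB order_refl)
  also have "\<dots> = P * Q * (u * A + v * B + A * B - S * T - 1)"
    by (simp add: algebra_simps)
  finally have "0 \<le> P * Q * (u * A + v * B + A * B - S * T - 1)" .
  moreover have "P * Q > 0" using p by simp
  ultimately have "u * A + v * B + A * B - S * T - 1 \<ge> 0"
    by (metis linorder_not_le mult_pos_neg)
  moreover have "(s - t)\<^sup>2 + (A + B)\<^sup>2 = 2 + 2 * u * A + 2 * v * B + 2 * A * B - 2 * (s * t)"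
    unfolding u(2) v(2) X_def Y_def by (simp add: algebra_simps power2_eq_square)
  moreover have "s * t \<le> S * T" unfolding S_def T_def by (metis abs_ge_self abs_mult)
  ultimately show ?thesis by linarith
qed

lemma lagrange_vec2: "(u \<bullet> v)\<^sup>2 + (cross u v)\<^sup>2 = (u \<bullet> u) * (v \<bullet> v)"
  by (simp add: inner_vec2 cross_def power2_eq_square algebra_simps)

lemma arccos_angle:
  fixes u v :: "real^2"
  assumes "u \<noteq> 0" "v \<noteq> 0"
  defines "\<theta> \<equiv> arccos (u \<bullet> v / (norm u * norm v))"
  shows "0 \<le> \<theta>" "\<theta> \<le> pi"
    and "norm u * norm v * cos \<theta> = u \<bullet> v" "norm u * norm v * sin \<theta> = \<bar>cross u v\<bar>"
proof -
  let ?n = "norm u * norm v"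
  have n: "?n > 0" using assms by simp
  have "\<bar>u \<bullet> v\<bar> \<le> ?n" by (rule Cauchy_Schwarz_ineq2)
  then have c: "- 1 \<le> u \<bullet> v / ?n" "u \<bullet> v / ?n \<le> 1"
    using n by (simp_all add: abs_le_iff pos_le_divide_eq pos_divide_le_eq)
  show "0 \<le> \<theta>" "\<theta> \<le> pi"
    unfolding \<theta>_def using arccos_lbound[OF c] arccos_ubound[OF c] by auto
  show "?n * cos \<theta> = u \<bullet> v"
    unfolding \<theta>_def cos_arccos[OF c] using n by simp
  have "?n\<^sup>2 = (u \<bullet> v)\<^sup>2 + (cross u v)\<^sup>2"
    by (simp add: lagrange_vec2 power_mult_distrib power2_norm_eq_inner)
  then have "((u \<bullet> v)\<^sup>2 + (cross u v)\<^sup>2) / ?n\<^sup>2 = 1"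
    using n by (metis divide_self less_irrefl zero_eq_power2)
  then have "1 - (u \<bullet> v / ?n)\<^sup>2 = (cross u v / ?n)\<^sup>2"
    unfolding power_divide add_divide_distrib by linarith
  then have "sin \<theta> = \<bar>cross u v / ?n\<bar>"
    unfolding \<theta>_def sin_arccos[OF c] by (simp only: real_sqrt_abs)
  also have "\<dots> = \<bar>cross u v\<bar> / ?n" using n by (simp only: abs_divide abs_of_pos)
  finally show "?n * sin \<theta> = \<bar>cross u v\<bar>"
    using n by (metis less_irrefl nonzero_mult_div_cancel_left times_divide_eq_right)
qed

text \<open>\<open>s\<close> is the position of \<open>x\<close> along \<open>ab\<close> and
  \<open>A\<close> its distance from that line in the frame with \<open>a\<close> at -1 and
  \<open>b\<close> at 1. The unit is half the length of \<open>ab\<close>, hence the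
  factors.\<close>

lemma chord_coordinates:
  fixes a b x :: "real^2"
  defines "w \<equiv> b - a"
  defines "s \<equiv> 2 * (w \<bullet> (x - a)) / (w \<bullet> w) - 1" and "A \<equiv> 2 * \<bar>cross w (x - a)\<bar> / (w \<bullet> w)"
  assumes "a \<noteq> b"
  shows "4 * (dist x a)\<^sup>2 = (w \<bullet> w) * ((1 + s)\<^sup>2 + A\<^sup>2)"
    and "4 * (dist x b)\<^sup>2 = (w \<bullet> w) * ((1 - s)\<^sup>2 + A\<^sup>2)"
    and "4 * ((a - x) \<bullet> (b - x)) = (w \<bullet> w) * (s\<^sup>2 - 1 + A\<^sup>2)"
    and "2 * \<bar>cross (a - x) (b - x)\<bar> = (w \<bullet> w) * A"
proof -
  define W p c where "W = w \<bullet> w" and "p = w \<bullet> (x - a)" and "c = \<bar>cross w (x - a)\<bar>"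
  have W: "W > 0" using assms by (simp add: W_def)
  have L: "W * ((x - a) \<bullet> (x - a)) = p\<^sup>2 + c\<^sup>2"
    by (simp add: W_def p_def c_def lagrange_vec2)
  have s: "s = 2 * p / W - 1" and A: "A = 2 * c / W"
    by (simp_all add: s_def A_def W_def p_def c_def)
  have xa: "(x - a) \<bullet> (x - a) = (p\<^sup>2 + c\<^sup>2) / W" using L W by (simp add: field_simps)
  have da: "(dist x a)\<^sup>2 = (p\<^sup>2 + c\<^sup>2) / W"
    unfolding dist_norm power2_norm_eq_inner by (rule xa)
  have db: "(dist x b)\<^sup>2 = (p\<^sup>2 + c\<^sup>2) / W - 2 * p + W"
    unfolding xa[symmetric] unfolding dist_norm power2_norm_eq_inner p_def W_def w_def
    by (simp add: algebra_simps inner_commute)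
  have dot: "(a - x) \<bullet> (b - x) = (p\<^sup>2 + c\<^sup>2) / W - p"
    unfolding xa[symmetric] unfolding p_def w_def by (simp add: algebra_simps inner_commute)
  have cr: "cross (a - x) (b - x) = cross w (x - a)"
    by (simp add: w_def cross_def algebra_simps)
  show "4 * (dist x a)\<^sup>2 = (w \<bullet> w) * ((1 + s)\<^sup>2 + A\<^sup>2)"
    unfolding da s A W_def[symmetric] using W by (simp add: field_simps power2_eq_square)
  show "4 * (dist x b)\<^sup>2 = (w \<bullet> w) * ((1 - s)\<^sup>2 + A\<^sup>2)"
    unfolding db s A W_def[symmetric] using W by (simp add: field_simps power2_eq_square)
  show "4 * ((a - x) \<bullet> (b - x)) = (w \<bullet> w) * (s\<^sup>2 - 1 + A\<^sup>2)"
    unfolding dot s A W_def[symmetric] using W by (simp add: field_simps power2_eq_square)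
  show "2 * \<bar>cross (a - x) (b - x)\<bar> = (w \<bullet> w) * A"
    unfolding cr A W_def[symmetric] using W by (simp add: c_def)
qed

text \<open>\<open>right\<close> makes both cotangents nonnegative. A sum of at most 5pi/6 would
  give \<open>dist x y \<ge> diameter K\<close> by \<open>opposite_points_far\<close>, against
  \<open>near\<close>.\<close>

lemma opposite_side_angle_sum:
  assumes K: "convex_body K" and abxy: "a \<in> K" "b \<in> K" "x \<in> K" "y \<in> K" and D: "dist a b = diameter K"
    and ne: "x \<noteq> a" "x \<noteq> b" "y \<noteq> a" "y \<noteq> b"
    and side: "cross (b - a) (x - a) * cross (b - a) (y - a) < 0"
    and near: "dist x y < diameter K"
    and right: "angle_at K x \<le> pi / 2" "angle_at K y \<le> pi / 2"
  shows "5 * pi / 6 < angle_at K x + angle_at K y"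
proof (rule ccontr)
  assume "\<not> ?thesis"
  then have sum: "angle_at K x + angle_at K y \<le> 5 * pi / 6" by simp
  have "a \<noteq> b" using side by (auto simp: cross_def)
  define w W where "w = b - a" and "W = w \<bullet> w"
  define cx cy where "cx = cross w (x - a)" and "cy = cross w (y - a)"
  define s t where "s = 2 * (w \<bullet> (x - a)) / W - 1" and "t = 2 * (w \<bullet> (y - a)) / W - 1"
  define A B where "A = 2 * \<bar>cx\<bar> / W" and "B = 2 * \<bar>cy\<bar> / W"
  have W: "W > 0" using \<open>a \<noteq> b\<close> by (simp add: W_def w_def)
  have WD: "W = (diameter K)\<^sup>2"
    by (simp add: W_def w_def D[symmetric] dist_norm norm_minus_commute[of a] power2_norm_eq_inner)
  have le: "(dist p q)\<^sup>2 \<le> W" if "p \<in> K" "q \<in> K" for p q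
    unfolding WD using diameter_bounded_bound[OF convex_body_facts(1)[OF K] that] by (simp add: power_mono)
  note X = chord_coordinates[OF \<open>a \<noteq> b\<close>, of x, folded w_def, folded W_def, folded cx_def, folded s_def A_def]
  note Y = chord_coordinates[OF \<open>a \<noteq> b\<close>, of y, folded w_def, folded W_def, folded cy_def, folded t_def B_def]
  have xy: "4 * (dist x y)\<^sup>2 = W * ((s - t)\<^sup>2 + (A + B)\<^sup>2)"
  proof -
    define p q where "p = w \<bullet> (x - a)" and "q = w \<bullet> (y - a)"
    have "p - q = w \<bullet> (x - y)" "cx - cy = cross w (x - y)"
      by (simp_all add: p_def q_def cx_def cy_def cross_def algebra_simps)
    then have dist: "(p - q)\<^sup>2 + (cx - cy)\<^sup>2 = W * (dist x y)\<^sup>2"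
      by (simp add: lagrange_vec2 W_def dist_norm power2_norm_eq_inner)
    \<comment> \<open>On opposite sides the distances from the line add up to the transverse
      separation of \<open>x\<close> and \<open>y\<close>.\<close>
    have "\<bar>cx\<bar> * \<bar>cy\<bar> = - (cx * cy)"
      using side by (simp add: cx_def cy_def w_def abs_mult[symmetric])
    then have abs: "(\<bar>cx\<bar> + \<bar>cy\<bar>)\<^sup>2 = (cx - cy)\<^sup>2"
      by (simp add: power2_sum power2_diff)
    have st: "s - t = 2 * (p - q) / W" and AB: "A + B = 2 * (\<bar>cx\<bar> + \<bar>cy\<bar>) / W"
      by (simp_all add: s_def t_def A_def B_def p_def q_def diff_divide_distrib add_divide_distrib)
    have scale: "W * ((2 * k / W)\<^sup>2 + (2 * l / W)\<^sup>2) = 4 * (k\<^sup>2 + l\<^sup>2) / W" for k l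
      using W by (simp add: field_simps power2_eq_square)
    show ?thesis
      unfolding st AB scale abs dist using W by simp
  qed
  have far: "(1 + \<bar>s\<bar>)\<^sup>2 + A\<^sup>2 \<le> 4" "(1 + \<bar>t\<bar>)\<^sup>2 + B\<^sup>2 \<le> 4"
  proof -
    have 1: "k \<le> 4" if "4 * (dist p q)\<^sup>2 = W * k" "p \<in> K" "q \<in> K" for k p q
    proof -
      have "W * k \<le> W * 4" using le[OF that(2,3)] that(1) by linarith
      then show ?thesis using W by simp
    qed
    \<comment> \<open>The absolute value selects the farther end: \<open>1 + s\<close> belongs to
      \<open>a\<close>, \<open>1 - s\<close> to \<open>b\<close>.\<close>
    show "(1 + \<bar>s\<bar>)\<^sup>2 + A\<^sup>2 \<le> 4"
      using 1[OF X(1)] 1[OF X(2)] abxy by (cases "s \<ge> 0") auto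
    show "(1 + \<bar>t\<bar>)\<^sup>2 + B\<^sup>2 \<le> 4"
      using 1[OF Y(1)] 1[OF Y(2)] abxy by (cases "t \<ge> 0") auto
  qed
  have "cx * cy < 0" using side by (simp add: cx_def cy_def w_def)
  then have "cx \<noteq> 0" "cy \<noteq> 0" by auto
  then have AB: "A > 0" "B > 0" using W unfolding A_def B_def by simp_all
  define \<alpha> where "\<alpha> = arccos ((a - x) \<bullet> (b - x) / (norm (a - x) * norm (b - x)))"
  define \<beta> where "\<beta> = arccos ((a - y) \<bullet> (b - y) / (norm (a - y) * norm (b - y)))"
  define L M where "L = norm (a - x) * norm (b - x)" and "M = norm (a - y) * norm (b - y)"
  have LM: "L > 0" "M > 0" using ne by (auto simp: L_def M_def)
  have le_angle: "\<alpha> \<le> angle_at K x" "\<beta> \<le> angle_at K y"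
    unfolding \<alpha>_def \<beta>_def using angle_at_ge[OF K] abxy ne by auto
  have nz: "a - x \<noteq> 0" "b - x \<noteq> 0" "a - y \<noteq> 0" "b - y \<noteq> 0" using ne by auto
  note \<alpha> = arccos_angle[OF nz(1,2), folded \<alpha>_def, folded L_def]
    and \<beta> = arccos_angle[OF nz(3,4), folded \<beta>_def, folded M_def]
  define X' where "X' = s\<^sup>2 - 1 + A\<^sup>2"
  define Y' where "Y' = t\<^sup>2 - 1 + B\<^sup>2"
  have ca: "L * cos \<alpha> = W * X' / 4" "L * sin \<alpha> = W * A / 2"
    using \<alpha>(3,4) X(3,4) unfolding X'_def by linarith+
  have cb: "M * cos \<beta> = W * Y' / 4" "M * sin \<beta> = W * B / 2"
    using \<beta>(3,4) Y(3,4) unfolding Y'_def by linarith+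
  have "cos \<alpha> \<ge> 0" "cos \<beta> \<ge> 0"
    using \<alpha>(1) \<beta>(1) le_angle right by (auto intro!: cos_ge_zero)
  then have "W * X' / 4 \<ge> 0" "W * Y' / 4 \<ge> 0" using LM by (simp_all flip: ca cb)
  then have XY: "X' \<ge> 0" "Y' \<ge> 0" using W by (simp_all add: zero_le_mult_iff)
  \<comment> \<open>The argument lies in \<open>{0..pi}\<close>. Expanding the sine turns the angle
    bound into the polynomial condition of \<open>opposite_points_far\<close>.\<close>
  have "0 \<le> sin (\<alpha> + \<beta> + pi / 6)"
    using \<alpha>(1) \<beta>(1) le_angle sum by (intro sin_ge_zero) auto
  then have "0 \<le> (2 * L * M) * sin (\<alpha> + \<beta> + pi / 6)" using LM by simp
  also have "\<dots> = (L * cos \<alpha>) * (M * cos \<beta>) - (L * sin \<alpha>) * (M * sin \<beta>)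
      + sqrt 3 * ((L * sin \<alpha>) * (M * cos \<beta>) + (L * cos \<alpha>) * (M * sin \<beta>))"
    unfolding sin_add[of "\<alpha> + \<beta>"] sin_add[of \<alpha>] cos_add[of \<alpha>] sin_30 cos_30 by (simp add: algebra_simps)
  also have "\<dots> = W\<^sup>2 / 16 * (X' * Y' - 4 * A * B + 2 * sqrt 3 * (A * Y' + B * X'))"
    unfolding ca cb by (simp add: algebra_simps power2_eq_square)
  finally have "0 \<le> W\<^sup>2 / 16 * (X' * Y' - 4 * A * B + 2 * sqrt 3 * (A * Y' + B * X'))" .
  moreover have "W\<^sup>2 / 16 > 0" using W by simp
  ultimately have "X' * Y' - 4 * A * B + 2 * sqrt 3 * (A * Y' + B * X') \<ge> 0"
    by (metis linorder_not_le mult_pos_neg)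
  then have "4 \<le> (s - t)\<^sup>2 + (A + B)\<^sup>2"
    using opposite_points_far[OF AB far] XY by (simp add: X'_def Y'_def)
  then have "W * 4 \<le> 4 * (dist x y)\<^sup>2" unfolding xy using W by simp
  moreover have "(dist x y)\<^sup>2 < W"
    unfolding WD using near by (intro power_strict_mono) auto
  ultimately show False by simp
qed

section \<open>Diametral points and the assertions for one, two and three points\<close>

lemma is_diameter_segment:
  assumes "convex_body K" "x \<in> K" "y \<in> K" "dist x y = diameter K"
  shows "is_diameter K (closed_segment x y)"
  unfolding is_diameter_def
  using assms closed_segment_subset[OF assms(2,3)] convex_body_facts(2)[OF assms(1)] by blast

lemma diametral_pointI:
  assumes "convex_body K" "x \<in> K" "y \<in> K" "dist x y = diameter K"
  shows "diametral_point K x"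
  using is_diameter_segment[OF assms] by (auto simp: diametral_point_def)

text \<open>Such an \<open>x\<close> is an end of a given diameter or, by
  \<open>narrow_angle_equilateral\<close>, at maximal distance from both its ends.\<close>

lemma narrow_angle_diameter:
  assumes K: "convex_body K" and x: "x \<in> K" "angle_at K x \<le> pi / 3"
  obtains y where "y \<in> K" "dist x y = diameter K"
proof -
  have "compact K" "K \<noteq> {}" using K by (auto simp: convex_body_def)
  then obtain a b where ab: "a \<in> K" "b \<in> K" "dist a b = diameter K"
    using diameter_compact_attained by blast
  show ?thesis
    using that narrow_angle_equilateral[OF K ab(1,2) x(1) ab(3) _ _ x(2)] ab
    by (metis dist_commute)
qed

lemma angle_gt_of_not_diametral:
  assumes "convex_body K" "x \<in> K" "\<not> diametral_point K x"
  shows "pi / 3 < angle_at K x"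
proof (rule ccontr)
  assume "\<not> ?thesis"
  then have "angle_at K x \<le> pi / 3" by simp
  from narrow_angle_diameter[OF assms(1,2) this] obtain y where "y \<in> K" "dist x y = diameter K" .
  then show False using diametral_pointI[OF assms(1,2)] assms(3) by blast
qed

text \<open>The same-side bound is kept for an arbitrary diameter, so that three points can be
  compared with a common one.\<close>

lemma pair_angle_sum:
  assumes K: "convex_body K" and xy: "x \<in> K" "y \<in> K" "x \<noteq> y"
    and nd: "\<not> diametral_point K x" "\<not> diametral_point K y"
  shows "5 * pi / 6 < angle_at K x + angle_at K y"
    and "\<lbrakk>a \<in> K; b \<in> K; dist a b = diameter K; cross (b - a) (x - a) * cross (b - a) (y - a) \<ge> 0\<rbrakk>
      \<Longrightarrow> pi \<le> angle_at K x + angle_at K y"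
proof -
  have ne: "x \<noteq> a \<and> x \<noteq> b \<and> y \<noteq> a \<and> y \<noteq> b" if "a \<in> K" "b \<in> K" "dist a b = diameter K" for a b
    using diametral_pointI[OF K] that nd by (metis dist_commute)
  show same: "pi \<le> angle_at K x + angle_at K y"
    if "a \<in> K" "b \<in> K" "dist a b = diameter K" "cross (b - a) (x - a) * cross (b - a) (y - a) \<ge> 0" for a b
    using same_side_angle_sum[OF K that(1,2) xy(1,2) that(3)] ne[OF that(1-3)] xy(3) that(4) by blast
  have gt: "pi / 3 < angle_at K x" "pi / 3 < angle_at K y"
    using angle_gt_of_not_diametral[OF K] xy nd by auto
  have "compact K" "K \<noteq> {}" using K by (auto simp: convex_body_def)
  then obtain a b where ab: "a \<in> K" "b \<in> K" "dist a b = diameter K"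
    using diameter_compact_attained by blast
  have near: "dist x y < diameter K"
    using diameter_bounded_bound[OF convex_body_facts(1)[OF K] xy(1,2)] diametral_pointI[OF K xy(1,2)] nd
    by fastforce
  show "5 * pi / 6 < angle_at K x + angle_at K y"
  proof (cases "cross (b - a) (x - a) * cross (b - a) (y - a) \<ge> 0")
    case True
    then show ?thesis using same[OF ab] pi_gt_zero by linarith
  next
    case False
    show ?thesis
    proof (cases "angle_at K x \<le> pi / 2 \<and> angle_at K y \<le> pi / 2")
      case True
      then show ?thesis
        using opposite_side_angle_sum[OF K ab(1,2) xy(1,2) ab(3)] ne[OF ab] False near by auto
    next
      \<comment> \<open>One angle exceeds pi/2 and the other pi/3, with total above 5pi/6.\<close>
      case False
      then show ?thesis using gt by linarith
    qed
  qed
qed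

theorem theorem2p3:
  fixes K :: "(real^2) set"
  assumes "convex_body K"
  shows
    "((\<forall>x\<in>frontier K. angle_at K x \<le> pi / 3 \<longrightarrow> diametral_point K x) \<and>
      (\<forall>x\<in>frontier K. \<forall>y\<in>frontier K.
         x \<noteq> y \<and> angle_at K x \<le> pi / 3 \<and> angle_at K y \<le> pi / 3 \<longrightarrow>
         is_diameter K (closed_segment x y))) \<and>
     (\<forall>x\<in>frontier K. \<forall>y\<in>frontier K.
        x \<noteq> y \<and> angle_at K x + angle_at K y \<le> 5 * pi / 6 \<longrightarrow>
        diametral_point K x \<or> diametral_point K y) \<and>
     (\<forall>x\<in>frontier K. \<forall>y\<in>frontier K. \<forall>z\<in>frontier K.
        x \<noteq> y \<and> y \<noteq> z \<and> x \<noteq> z \<and>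
        angle_at K x + angle_at K y + angle_at K z \<le> 4 * pi / 3 \<longrightarrow>
        diametral_point K x \<or> diametral_point K y \<or> diametral_point K z)"
proof -
  note K = assms
  have fr: "x \<in> K" if "x \<in> frontier K" for x
    using that K frontier_subset_closed[of K] by (auto simp: convex_body_def compact_imp_closed)
  have i: "diametral_point K x" if "x \<in> frontier K" "angle_at K x \<le> pi / 3" for x
    using angle_gt_of_not_diametral[OF K fr[OF that(1)]] that(2) by force
  have i': "is_diameter K (closed_segment x y)"
    if xy: "x \<in> frontier K" "y \<in> frontier K" "x \<noteq> y" "angle_at K x \<le> pi / 3" "angle_at K y \<le> pi / 3" for x y
  proof -
    obtain p where p: "p \<in> K" "dist x p = diameter K"
      using narrow_angle_diameter[OF K fr[OF xy(1)] xy(4)] .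
    \<comment> \<open>Either \<open>y\<close> is \<open>p\<close>, or \<open>y\<close> sees the
      diameter from \<open>x\<close> to \<open>p\<close> under at most pi/3 and the three points
      form an equilateral triangle.\<close>
    have "dist x y = diameter K"
      using narrow_angle_equilateral[OF K fr[OF xy(1)] p(1) fr[OF xy(2)] p(2) _ _ xy(5)] xy(3) p(2)
      by (metis dist_commute)
    then show ?thesis using is_diameter_segment[OF K fr fr] xy by blast
  qed
  have ii: "diametral_point K x \<or> diametral_point K y"
    if "x \<in> frontier K" "y \<in> frontier K" "x \<noteq> y" "angle_at K x + angle_at K y \<le> 5 * pi / 6" for x y
    using pair_angle_sum(1)[OF K fr fr, of x y] that by linarith
  have iii: "diametral_point K x \<or> diametral_point K y \<or> diametral_point K z"
    if f: "x \<in> frontier K" "y \<in> frontier K" "z \<in> frontier K" and d: "x \<noteq> y" "y \<noteq> z" "x \<noteq> z"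
      and sum: "angle_at K x + angle_at K y + angle_at K z \<le> 4 * pi / 3" for x y z
  proof (rule ccontr)
    assume "\<not> ?thesis"
    then have nd: "\<not> diametral_point K x" "\<not> diametral_point K y" "\<not> diametral_point K z" by auto
    then have gt: "pi / 3 < angle_at K x" "pi / 3 < angle_at K y" "pi / 3 < angle_at K z"
      using angle_gt_of_not_diametral[OF K fr] f by auto
    have "compact K" "K \<noteq> {}" using K by (auto simp: convex_body_def)
    then obtain a b where ab: "a \<in> K" "b \<in> K" "dist a b = diameter K"
      using diameter_compact_attained by blast
    let ?h = "\<lambda>v. cross (b - a) (v - a)"
    \<comment> \<open>Among three reals two have the same weak sign. That pair contributes at least
      \<open>pi\<close>, the third point more than pi/3.\<close>
    consider "?h x * ?h y \<ge> 0" | "?h y * ?h z \<ge> 0" | "?h x * ?h z \<ge> 0"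
      by (metis linorder_le_cases mult_nonneg_nonneg mult_nonpos_nonpos)
    then have "pi \<le> angle_at K x + angle_at K y \<or> pi \<le> angle_at K y + angle_at K z
        \<or> pi \<le> angle_at K x + angle_at K z"
      using pair_angle_sum(2)[OF K fr fr _ _ _ ab] f d nd by cases blast+
    then show False using gt sum by linarith
  qed
  show ?thesis using i i' ii iii by blast
qed

end
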